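(* Assume $\|\varphi\|_{C^2([a,b])}<1$. Then there is a constant $C_0>0$ depending only on $\|w\|_{C^2([a,b])}$ such that for all $(s,x)\in[0,1]\times\mathbb R$, $$|\partial_xg(s,x)-1|\le C_0\|\varphi\|_{C^2([a,b])},\qquad|\partial_xh(s,x)-w'(x)|\le C_0\|\varphi\|_{C^2([a,b])}.$$
   Context: Let $w\in C^3(\mathbb R)$ be periodic with $w>0$ on $[-1,1]$. Let $-1<a<b<1$ and let $\varphi:[a,b]\to\mathbb R$ be a polynomial with $\varphi^{(k)}(a)=\varphi^{(k)}(b)=0$ for $k=0,1,2,3$, extended by zero outside $[a,b]$. For $x\in\mathbb R$, $(\xi(t,x),\eta(t,x))$ is the unique global solution of $$\frac{d\xi}{dt}=-w'(\xi)\varphi(\xi)-(\eta-w(\xi))\varphi'(\xi),\quad\frac{d\eta}{dt}=\varphi(\xi),\quad \xi(0)=x,\ \eta(0)=w(x).$$ For $s\in[0,1]$, $t_0(s,x)\ge0$ denotes the first time $t\ge0$ with $\eta(t,x)=w(\xi(t,x))+s\varphi(\xi(t,x))$ (it exists). $g(s,x)=\xi(t_0(s,x),x)$ and $h(s,x)=\eta(t_0(s,x),x)=w(g(s,x))+s\varphi(g(s,x))$; both are $C^2$ functions on $[0,1]\times\mathbb R$. *)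

theory Defs
  imports "HOL-Analysis.Analysis" "HOL-Computational_Algebra.Polynomial"
begin

definition nderiv :: "nat \<Rightarrow> (real \<Rightarrow> real) \<Rightarrow> real \<Rightarrow> real" where
  "nderiv k f = (deriv ^^ k) f"

definition Ck :: "nat \<Rightarrow> (real \<Rightarrow> real) \<Rightarrow> bool" where
  "Ck n f \<longleftrightarrow> (\<forall>k<n. \<forall>x. (nderiv k f has_real_derivative nderiv (Suc k) f x) (at x))
               \<and> continuous_on UNIV (nderiv n f)"

definition periodic :: "(real \<Rightarrow> real) \<Rightarrow> bool" where
  "periodic f \<longleftrightarrow> (\<exists>T>0. \<forall>x. f (x + T) = f x)"

definition C2norm :: "(real \<Rightarrow> real) \<Rightarrow> real \<Rightarrow> real \<Rightarrow> real" where
  "C2norm f a b = (\<Sum>k\<le>2. SUP x\<in>{a..b}. \<bar>nderiv k f x\<bar>)"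

definition zext :: "real poly \<Rightarrow> real \<Rightarrow> real \<Rightarrow> real \<Rightarrow> real" where
  "zext p a b x = (if a \<le> x \<and> x \<le> b then poly p x else 0)"

definition hit_time :: "(real \<Rightarrow> real \<Rightarrow> real) \<Rightarrow> (real \<Rightarrow> real \<Rightarrow> real) \<Rightarrow> (real \<Rightarrow> real)
    \<Rightarrow> (real \<Rightarrow> real) \<Rightarrow> real \<Rightarrow> real \<Rightarrow> real" where
  "hit_time \<xi> \<eta> w \<phi> s x = Inf {t. 0 \<le> t \<and> \<eta> t x = w (\<xi> t x) + s * \<phi> (\<xi> t x)}"

end

theory Submission
  imports Defs
begin

text \<open>
  Along a trajectory starting at \<open>x\<close> with \<open>\<phi> x \<noteq> 0\<close>, the pair
  \<open>u = \<eta> - w \<circ> \<xi>\<close>, \<open>f = \<phi> \<circ> \<xi>\<close> solves a linear system, and \<open>s = u / f\<close> satisfies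
  \<open>ds/dt = 1 + (w' + s \<phi>')\<^sup>2\<close>. Hence \<open>s\<close> may replace \<open>t\<close> as the time variable, the hitting time is
  the inverse function of \<open>s\<close>, and \<open>g\<close> is the flow of the scalar equation
  \<open>\<partial>g/\<partial>s = - \<phi>(g) R(w'(g) + s \<phi>'(g))\<close> with \<open>R(v) = v / (1 + v\<^sup>2)\<close>. This also holds trivially
  when \<open>\<phi> x = 0\<close>, where the hitting time is 0. The right-hand side and its \<open>g\<close>-derivative are of
  the order of the \<open>C\<^sup>2\<close> norm of \<open>\<phi>\<close>, and \<open>\<partial>g/\<partial>x\<close> is the exponential of the integral of that
  \<open>g\<close>-derivative along the flow.
\<close>

section \<open>Differentiable dependence of a scalar flow on its initial value\<close>

lemma increasing_within:
  fixes q :: "real \<Rightarrow> real"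
  assumes "0 \<le> T"
    and "\<And>s. s \<in> {0..T} \<Longrightarrow> (q has_real_derivative q' s) (at s within {0..T})"
    and "\<And>s. s \<in> {0..T} \<Longrightarrow> 0 \<le> q' s"
  shows "q 0 \<le> q T"
proof -
  have "\<exists>s\<in>{0..T}. q T - q 0 = q' s * (T - 0)"
    by (rule mvt_very_simple[OF assms(1)]) (use assms(2) in \<open>auto simp: has_field_derivative_def\<close>)
  then show ?thesis
    using assms(1,3) by (metis diff_ge_0_iff_ge diff_zero mult_nonneg_nonneg)
qed

text \<open>Gronwall: since \<open>G s\<close> is \<open>L\<close>-Lipschitz in space, the squared
  distance of two trajectories times \<open>exp (- 2 * L * s)\<close> cannot increase. Squaring
  avoids differentiating an absolute value at zero, and the minus sign in \<open>q\<close> turns the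
  decrease into an increase.\<close>

lemma flow_gronwall:
  fixes G G' g :: "real \<Rightarrow> real \<Rightarrow> real"
  assumes G: "\<And>s y. s \<in> {0..T} \<Longrightarrow> (G s has_real_derivative G' s y) (at y)"
    and bnd: "\<And>s y. s \<in> {0..T} \<Longrightarrow> \<bar>G' s y\<bar> \<le> L"
    and g0: "\<And>x. g 0 x = x"
    and g: "\<And>s x. s \<in> {0..T} \<Longrightarrow>
              ((\<lambda>s. g s x) has_real_derivative G s (g s x)) (at s within {0..T})"
    and s: "s \<in> {0..T}"
  shows "\<bar>g s y - g s x\<bar> \<le> \<bar>y - x\<bar> * exp (L * s)"
proof -
  have lip: "\<bar>G r z - G r z'\<bar> \<le> L * \<bar>z - z'\<bar>" if "r \<in> {0..T}" for r z z'
    using field_differentiable_bound[of UNIV "G r" "G' r" L z z'] G[OF that] bnd[OF that] by auto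
  define q where "q r = - (((g r y - g r x) * exp (- L * r))\<^sup>2)" for r
  define q' where "q' r = 2 * (exp (- L * r))\<^sup>2 *
      (L * (g r y - g r x)\<^sup>2 - (g r y - g r x) * (G r (g r y) - G r (g r x)))" for r
  have "q 0 \<le> q s"
  proof (rule increasing_within)
    show "0 \<le> s" using s by auto
    fix r assume r: "r \<in> {0..s}"
    then have rT: "r \<in> {0..T}" using s by auto
    have d: "((\<lambda>s. g s z) has_real_derivative G r (g r z)) (at r within {0..s})" for z
      by (rule DERIV_subset[OF g[OF rT]]) (use s in auto)
    show "(q has_real_derivative q' r) (at r within {0..s})"
      unfolding q_def q'_def
      by (auto intro!: derivative_eq_intros d simp: algebra_simps power2_eq_square)
    have "(g r y - g r x) * (G r (g r y) - G r (g r x))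
          \<le> \<bar>g r y - g r x\<bar> * \<bar>G r (g r y) - G r (g r x)\<bar>"
      by (metis abs_ge_self abs_mult)
    also have "\<dots> \<le> \<bar>g r y - g r x\<bar> * (L * \<bar>g r y - g r x\<bar>)"
      by (intro mult_left_mono lip rT) auto
    also have "\<dots> = L * (g r y - g r x)\<^sup>2"
      by (simp add: power2_eq_square)
    finally show "0 \<le> q' r" unfolding q'_def by simp
  qed
  then have "((g s y - g s x) * exp (- L * s))\<^sup>2 \<le> (y - x)\<^sup>2"
    by (simp add: q_def g0)
  then have "\<bar>g s y - g s x\<bar> * exp (- L * s) \<le> \<bar>y - x\<bar>"
    by (metis abs_exp_cancel abs_le_square_iff abs_mult)
  then show ?thesis
    by (simp add: exp_minus field_simps)
qed

text \<open>The derivative solves the variational equation, whose solution with initial value 1 is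
  the exponential of the integral of \<open>G'\<close> along the trajectory of \<open>x\<close>.
  Only the size of the exponent matters later, hence the existential \<open>I\<close>. The bound
  \<open>B\<close> along this one trajectory is kept apart from the global \<open>L\<close>, because
  it will be 0 for some starting points.\<close>

lemma flow_deriv_initial:
  fixes G G' g :: "real \<Rightarrow> real \<Rightarrow> real"
  assumes G: "\<And>s y. s \<in> {0..T} \<Longrightarrow> (G s has_real_derivative G' s y) (at y)"
    and cont: "continuous_on ({0..T} \<times> UNIV) (\<lambda>(s, y). G' s y)"
    and bnd: "\<And>s y. s \<in> {0..T} \<Longrightarrow> \<bar>G' s y\<bar> \<le> L"
    and g0: "\<And>x. g 0 x = x"
    and g: "\<And>s x. s \<in> {0..T} \<Longrightarrow>
              ((\<lambda>s. g s x) has_real_derivative G s (g s x)) (at s within {0..T})"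
    and B: "\<And>s. s \<in> {0..T} \<Longrightarrow> \<bar>G' s (g s x)\<bar> \<le> B"
    and \<sigma>: "\<sigma> \<in> {0..T}"
  shows "\<exists>I. \<bar>I\<bar> \<le> B * \<sigma> \<and> (g \<sigma> has_real_derivative exp I) (at x)"
proof -
  have T: "0 \<le> T" using \<sigma> by auto
  have gc: "continuous_on {0..T} (\<lambda>s. g s z)" for z
    using g by (meson DERIV_continuous continuous_on_eq_continuous_within)
  define a where "a s = G' s (g s x)" for s
  have ac: "continuous_on {0..T} a"
  proof -
    have "continuous_on {0..T} ((\<lambda>(s, y). G' s y) \<circ> (\<lambda>s. (s, g s x)))"
      by (rule continuous_on_compose[OF _ continuous_on_subset[OF cont]])
        (auto intro!: continuous_intros gc)
    then show ?thesis by (simp add: a_def o_def)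
  qed
  define A where "A s = integral {0..s} a" for s
  have A0: "A 0 = 0" by (simp add: A_def)
  have dA: "(A has_real_derivative a s) (at s within {0..T})" if "s \<in> {0..T}" for s
    unfolding A_def by (rule integral_has_real_derivative[OF ac that])
  have Ab: "\<bar>A s\<bar> \<le> B * s" if "s \<in> {0..T}" for s
    using field_differentiable_bound[of "{0..T}" A a B s 0] dA B that T A0 by (auto simp: a_def)
  have B0: "0 \<le> B" using B[OF \<sigma>] by linarith
  \<comment> \<open>The trajectory of \<open>x\<close> stays in \<open>{-c..c}\<close>; the margin 1
    added below leaves room for nearby trajectories inside a compact set, on which \<open>G'\<close>
    is uniformly continuous.\<close>
  obtain c where c: "\<And>s. s \<in> {0..T} \<Longrightarrow> \<bar>g s x\<bar> \<le> c"
    using compact_imp_bounded[OF compact_continuous_image[OF gc compact_Icc], of x]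
    unfolding bounded_iff by force
  have L0: "0 \<le> L" using bnd[OF \<sigma>, of 0] by linarith
  have uc: "uniformly_continuous_on ({0..T} \<times> {-c-1..c+1}) (\<lambda>(s, y). G' s y)"
    by (rule compact_uniformly_continuous[OF continuous_on_subset[OF cont]])
      (auto intro!: compact_Times)
  \<comment> \<open>\<open>C\<close> collects the losses of the final estimate: undoing the
    integrating factor, bounding it, Gronwall, and the length of the interval. It is 0 if
    \<open>T = 0\<close>, hence the \<open>C + 1\<close> in the choice of
    \<open>\<epsilon>\<close>.\<close>
  define C where "C = exp (A \<sigma>) * (exp (B * T) * exp (L * T)) * T"
  have C0: "0 \<le> C" using T by (simp add: C_def)
  have main: "\<exists>d>0. \<forall>y. \<bar>y - x\<bar> < d \<longrightarrow>
      \<bar>g \<sigma> y - g \<sigma> x - exp (A \<sigma>) * (y - x)\<bar> \<le> e * \<bar>y - x\<bar>" if e: "e > 0" for e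
  proof -
    define \<epsilon> where "\<epsilon> = e / (C + 1)"
    have \<epsilon>: "\<epsilon> > 0" using e C0 by (simp add: \<epsilon>_def)
    obtain d where d: "d > 0" and dd: "\<And>s y y'. \<lbrakk>s \<in> {0..T}; y \<in> {-c-1..c+1}; y' \<in> {-c-1..c+1}; \<bar>y - y'\<bar> < d\<rbrakk>
        \<Longrightarrow> \<bar>G' s y - G' s y'\<bar> < \<epsilon>"
    proof -
      obtain d where "d > 0" and *: "\<And>p p'. \<lbrakk>p \<in> {0..T} \<times> {-c-1..c+1}; p' \<in> {0..T} \<times> {-c-1..c+1}; dist p' p < d\<rbrakk>
         \<Longrightarrow> dist ((\<lambda>(s, y). G' s y) p') ((\<lambda>(s, y). G' s y) p) < \<epsilon>"
        using uc \<epsilon> unfolding uniformly_continuous_on_def by meson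
      have "\<bar>G' s y - G' s y'\<bar> < \<epsilon>" if "s \<in> {0..T}" "y \<in> {-c-1..c+1}" "y' \<in> {-c-1..c+1}" "\<bar>y - y'\<bar> < d" for s y y'
        using *[of "(s, y')" "(s, y)"] that by (auto simp: dist_Pair_Pair dist_real_def)
      then show thesis using that \<open>d > 0\<close> by blast
    qed
    define \<rho> where "\<rho> = min 1 d"
    have \<rho>: "0 < \<rho>" "\<rho> \<le> 1" "\<rho> \<le> d" using d by (auto simp: \<rho>_def)
    \<comment> \<open>By Gronwall, a trajectory starting within
      \<open>\<rho> * exp (- L * T)\<close> of \<open>x\<close> stays within \<open>\<rho>\<close>
      of that of \<open>x\<close> up to time \<open>T\<close>.\<close>
    show ?thesis
    proof (intro exI[of _ "\<rho> * exp (- L * T)"] conjI allI impI)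
      show "0 < \<rho> * exp (- L * T)" using \<rho> by simp
      fix y assume y: "\<bar>y - x\<bar> < \<rho> * exp (- L * T)"
      define \<delta> where "\<delta> s = g s y - g s x" for s
      have \<delta>: "\<bar>\<delta> s\<bar> \<le> \<bar>y - x\<bar> * exp (L * T)" if s: "s \<in> {0..T}" for s
      proof -
        have "\<bar>\<delta> s\<bar> \<le> \<bar>y - x\<bar> * exp (L * s)"
          unfolding \<delta>_def by (rule flow_gronwall[OF G bnd g0 g s])
        also have "\<dots> \<le> \<bar>y - x\<bar> * exp (L * T)"
          using s L0 by (intro mult_left_mono) (auto intro: mult_left_mono)
        finally show ?thesis .
      qed
      have y': "\<bar>y - x\<bar> * exp (L * T) < \<rho>"
        using y by (simp add: exp_minus field_simps)
      \<comment> \<open>First-order Taylor remainder: the mean value inequality is applied to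
        \<open>\<lambda>z. G s z - a s * z\<close>, whose derivative is at most
        \<open>\<epsilon>\<close> in absolute value within \<open>\<rho>\<close> of
        \<open>g s x\<close>.\<close>
      have rem: "\<bar>G s (g s y) - G s (g s x) - a s * \<delta> s\<bar> \<le> \<epsilon> * \<bar>\<delta> s\<bar>" if s: "s \<in> {0..T}" for s
      proof -
        have "norm ((G s (g s y) - a s * g s y) - (G s (g s x) - a s * g s x)) \<le> \<epsilon> * norm (g s y - g s x)"
        proof (rule field_differentiable_bound[where S = "ball (g s x) \<rho>"
              and f' = "\<lambda>z. G' s z - a s"])
          fix z assume z: "z \<in> ball (g s x) \<rho>"
          show "((\<lambda>z. G s z - a s * z) has_field_derivative G' s z - a s) (at z within ball (g s x) \<rho>)"
            by (auto intro!: derivative_eq_intros DERIV_subset[OF G[OF s]])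
          show "norm (G' s z - a s) \<le> \<epsilon>"
          proof -
            have "\<bar>z - g s x\<bar> < \<rho>" using z by (simp add: dist_real_def)
            then have "z \<in> {-c-1..c+1}" "g s x \<in> {-c-1..c+1}" "\<bar>z - g s x\<bar> < d"
              using \<rho> c[OF s] unfolding atLeastAtMost_iff by linarith+
            from dd[OF s this] show ?thesis by (simp add: a_def)
          qed
        qed (use \<rho> \<delta>[OF s] y' in \<open>auto simp: \<delta>_def dist_real_def\<close>)
        then show ?thesis by (simp add: \<delta>_def algebra_simps)
      qed
      \<comment> \<open>\<open>exp (- A s)\<close> is an integrating factor: in the derivative of
        \<open>z\<close> the linear term cancels and only the remainder survives.\<close>
      define z where "z s = \<delta> s * exp (- A s)" for s
      define z' where "z' s = exp (- A s) * (G s (g s y) - G s (g s x) - a s * \<delta> s)" for s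
      have "norm (z \<sigma> - z 0) \<le> (exp (B * T) * (\<epsilon> * (\<bar>y - x\<bar> * exp (L * T)))) * norm (\<sigma> - 0)"
      proof (rule field_differentiable_bound[where S = "{0..T}" and f' = z'])
        fix s assume s: "s \<in> {0..T}"
        show "(z has_field_derivative z' s) (at s within {0..T})"
          unfolding z_def z'_def \<delta>_def
          by (auto intro!: derivative_eq_intros g[OF s] dA[OF s] simp: algebra_simps)
        have "- A s \<le> B * T"
          using Ab[OF s] s B0 mult_left_mono[of s T B] by auto
        then show "norm (z' s) \<le> exp (B * T) * (\<epsilon> * (\<bar>y - x\<bar> * exp (L * T)))"
          unfolding z'_def real_norm_def abs_mult abs_exp_cancel
          by (intro mult_mono order_trans[OF rem[OF s]] mult_left_mono \<delta>[OF s])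
            (use \<epsilon> in auto)
      qed (use \<sigma> T in auto)
      also have "\<dots> \<le> (exp (B * T) * (\<epsilon> * (\<bar>y - x\<bar> * exp (L * T)))) * T"
        using \<sigma> \<epsilon> by (intro mult_left_mono) auto
      finally have *: "\<bar>z \<sigma> - (y - x)\<bar> \<le> (exp (B * T) * (\<epsilon> * (\<bar>y - x\<bar> * exp (L * T)))) * T"
        by (simp add: z_def \<delta>_def A0 g0)
      have "g \<sigma> y - g \<sigma> x - exp (A \<sigma>) * (y - x) = exp (A \<sigma>) * (z \<sigma> - (y - x))"
        by (simp add: z_def \<delta>_def exp_minus field_simps)
      then have "\<bar>g \<sigma> y - g \<sigma> x - exp (A \<sigma>) * (y - x)\<bar> = exp (A \<sigma>) * \<bar>z \<sigma> - (y - x)\<bar>"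
        by (simp add: abs_mult)
      also have "\<dots> \<le> exp (A \<sigma>) * ((exp (B * T) * (\<epsilon> * (\<bar>y - x\<bar> * exp (L * T)))) * T)"
        by (rule mult_left_mono[OF *]) simp
      also have "\<dots> = (C * \<epsilon>) * \<bar>y - x\<bar>"
        by (simp add: C_def)
      also have "\<dots> \<le> e * \<bar>y - x\<bar>"
        by (rule mult_right_mono) (use e C0 in \<open>auto simp: \<epsilon>_def field_simps\<close>)
      finally show "\<bar>g \<sigma> y - g \<sigma> x - exp (A \<sigma>) * (y - x)\<bar> \<le> e * \<bar>y - x\<bar>" .
    qed
  qed
  have "(g \<sigma> has_real_derivative exp (A \<sigma>)) (at x)"
    unfolding has_field_derivative_def has_derivative_at_alt
    using main by (auto intro: bounded_linear_mult_right)
  then show ?thesis using Ab[OF \<sigma>] by blast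
qed

section \<open>The linear system and its Riccati quotient\<close>

text \<open>The energy \<open>N\<close>, the sum of squares, changes at a rate of at most
  \<open>k * N\<close> in absolute value. With \<open>K\<close> bounding \<open>k\<close> on
  \<open>{0..t}\<close>, the product \<open>N r * exp (K * r)\<close> is nondecreasing, so
  \<open>N\<close> cannot fall to 0. The weights in \<open>k\<close> come from bounding
  \<open>2 * u * f\<close> and the difference of the squares by \<open>N\<close>.\<close>

lemma linear_system_nonvanishing:
  fixes u f \<alpha> \<beta> :: "real \<Rightarrow> real"
  assumes du: "\<And>t. (u has_real_derivative (1 + (\<alpha> t)\<^sup>2) * f t + \<alpha> t * \<beta> t * u t) (at t)"
    and df: "\<And>t. (f has_real_derivative - \<alpha> t * \<beta> t * f t - (\<beta> t)\<^sup>2 * u t) (at t)"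
    and ca: "continuous_on UNIV \<alpha>" and cb: "continuous_on UNIV \<beta>"
    and f0: "f 0 \<noteq> 0" and t: "0 \<le> t"
  shows "0 < (u t)\<^sup>2 + (f t)\<^sup>2"
proof -
  define k where "k t = \<bar>1 + (\<alpha> t)\<^sup>2 - (\<beta> t)\<^sup>2\<bar> + 2 * \<bar>\<alpha> t * \<beta> t\<bar>" for t
  have kc: "continuous_on {0..t} k" unfolding k_def
    by (intro continuous_intros continuous_on_subset[OF ca] continuous_on_subset[OF cb]) auto
  have "{0..t} \<noteq> {}" using t by simp
  from continuous_attains_sup[OF compact_Icc this kc]
  obtain K where K: "\<And>r. r \<in> {0..t} \<Longrightarrow> k r \<le> K" by blast
  define N where "N r = (u r)\<^sup>2 + (f r)\<^sup>2" for r
  have dN: "(N has_real_derivative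
      2 * u r * f r * (1 + (\<alpha> r)\<^sup>2 - (\<beta> r)\<^sup>2) + 2 * (\<alpha> r * \<beta> r) * ((u r)\<^sup>2 - (f r)\<^sup>2)) (at r)" for r
    unfolding N_def
    by (auto intro!: derivative_eq_intros du df simp: algebra_simps power2_eq_square)
  have N: "N 0 * exp (K * 0) \<le> N t * exp (K * t)"
  proof (rule DERIV_nonneg_imp_nondecreasing[OF t], intro exI conjI)
    fix r assume r: "0 \<le> r" "r \<le> t"
    let ?D = "2 * u r * f r * (1 + (\<alpha> r)\<^sup>2 - (\<beta> r)\<^sup>2) + 2 * (\<alpha> r * \<beta> r) * ((u r)\<^sup>2 - (f r)\<^sup>2)"
    show "((\<lambda>r. N r * exp (K * r)) has_real_derivative exp (K * r) * (?D + K * N r)) (at r)"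
      by (auto intro!: derivative_eq_intros dN simp: algebra_simps)
    have "\<bar>2 * u r * f r\<bar> \<le> N r"
      using sum_squares_bound[of "\<bar>u r\<bar>" "\<bar>f r\<bar>"] by (simp add: N_def abs_mult)
    moreover have "\<bar>(u r)\<^sup>2 - (f r)\<^sup>2\<bar> \<le> N r"
      by (auto simp: N_def abs_le_iff)
    ultimately have "\<bar>2 * u r * f r * (1 + (\<alpha> r)\<^sup>2 - (\<beta> r)\<^sup>2)\<bar> \<le> N r * \<bar>1 + (\<alpha> r)\<^sup>2 - (\<beta> r)\<^sup>2\<bar>"
      "\<bar>2 * (\<alpha> r * \<beta> r) * ((u r)\<^sup>2 - (f r)\<^sup>2)\<bar> \<le> 2 * \<bar>\<alpha> r * \<beta> r\<bar> * N r"
      by (simp_all add: abs_mult mult_right_mono mult_left_mono)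
    then have "\<bar>?D\<bar> \<le> k r * N r" by (simp add: k_def algebra_simps)
    also have "\<dots> \<le> K * N r"
      using K[of r] r by (intro mult_right_mono) (auto simp: N_def)
    finally show "0 \<le> exp (K * r) * (?D + K * N r)" by simp
  qed
  have "0 < N 0" using f0 by (simp add: N_def sum_power2_gt_zero_iff)
  then have "0 < N t * exp (K * t)" using N by simp
  then show ?thesis by (simp add: N_def zero_less_mult_iff)
qed

text \<open>The quotient \<open>u / f\<close> solves the Riccati equation \<open>S' = 1 + (\<alpha> + S \<beta>)\<^sup>2\<close> as long as
  \<open>f \<noteq> 0\<close>. It may blow up in finite time, but only by increasing to infinity, because \<open>u\<close> and
  \<open>f\<close> never vanish simultaneously; so all values in \<open>[0, 1]\<close> are attained before the blow-up.\<close>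

lemma ratio_hits_pos:
  fixes u f \<alpha> \<beta> :: "real \<Rightarrow> real"
  assumes du: "\<And>t. (u has_real_derivative (1 + (\<alpha> t)\<^sup>2) * f t + \<alpha> t * \<beta> t * u t) (at t)"
    and df: "\<And>t. (f has_real_derivative - \<alpha> t * \<beta> t * f t - (\<beta> t)\<^sup>2 * u t) (at t)"
    and ca: "continuous_on UNIV \<alpha>" and cb: "continuous_on UNIV \<beta>"
    and u0: "u 0 = 0" and f0: "f 0 > 0"
  shows "\<exists>\<tau>. \<forall>s\<in>{0..1}. 0 \<le> \<tau> s \<and> f (\<tau> s) \<noteq> 0 \<and> u (\<tau> s) = s * f (\<tau> s)
            \<and> (\<forall>t. 0 \<le> t \<and> u t = s * f t \<longrightarrow> \<tau> s \<le> t)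
            \<and> (\<tau> has_real_derivative inverse (1 + (\<alpha> (\<tau> s) + s * \<beta> (\<tau> s))\<^sup>2)) (at s)"
proof -
  define S where "S t = u t / f t" for t
  define S' where "S' t = 1 + (\<alpha> t + S t * \<beta> t)\<^sup>2" for t
  have uc: "continuous_on X u" and fc: "continuous_on X f" for X
    by (intro continuous_at_imp_continuous_on ballI DERIV_isCont[OF du] DERIV_isCont[OF df])+
  have dS: "(S has_real_derivative S' t) (at t)" if "f t \<noteq> 0" for t
    unfolding S_def S'_def using that
    by (auto intro!: derivative_eq_intros du df simp: field_simps power2_eq_square)
  have S'1: "1 \<le> S' t" for t by (simp add: S'_def)
  \<comment> \<open>\<open>S\<close> starts at 0 and has slope at least 1 while \<open>f\<close>
    stays positive.\<close>
  have S_ge: "t \<le> S t" if "0 \<le> t" and pos: "\<And>r. r \<in> {0..t} \<Longrightarrow> 0 < f r" for t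
  proof -
    have "S 0 - 0 \<le> S t - t"
    proof (rule DERIV_nonneg_imp_nondecreasing[OF \<open>0 \<le> t\<close>], intro exI conjI)
      fix r assume r: "0 \<le> r" "r \<le> t"
      show "((\<lambda>r. S r - r) has_real_derivative S' r - 1) (at r)"
        by (intro derivative_intros dS) (use pos[of r] r in auto)
      show "0 \<le> S' r - 1" using S'1[of r] by simp
    qed
    then show ?thesis by (simp add: S_def u0)
  qed
  \<comment> \<open>Either \<open>f\<close> is positive on \<open>{0..1}\<close> and
    \<open>t1 = 1\<close> works, or \<open>f\<close> has a first zero \<open>z\<close>. There
    \<open>u z > 0\<close>, so \<open>u - f\<close> goes from \<open>- f 0 < 0\<close> to a positive
    value and vanishes at some time before \<open>z\<close>, where the quotient is 1.\<close>
  obtain t1 where t1: "0 \<le> t1" "\<And>t. t \<in> {0..t1} \<Longrightarrow> 0 < f t" "1 \<le> S t1"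
  proof (cases "\<forall>t\<in>{0..1}. 0 < f t")
    case True
    then show thesis using that[of 1] S_ge[of 1] by auto
  next
    case False
    define Z where "Z = {0..1} \<inter> {t. f t \<le> 0}"
    define z where "z = Inf Z"
    have Z: "closed Z" "Z \<noteq> {}" "bdd_below Z"
      unfolding Z_def using False
      by (auto intro!: closed_Int closed_Collect_le fc continuous_intros simp: not_less) 
    then have zZ: "z \<in> Z" unfolding z_def by (intro closed_contains_Inf) auto
    then have z0: "0 < z" using f0 by (cases "z = 0") (auto simp: Z_def)
    have before: "0 < f t" if "0 \<le> t" "t < z" for t
      using cInf_lower[OF _ Z(3), of t] that zZ by (force simp: Z_def z_def)
    have u_before: "0 \<le> u t" if "0 \<le> t" "t < z" for t
    proof -
      have "0 \<le> S t" using S_ge[of t] before that by force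
      then show ?thesis using before[OF that] by (simp add: S_def zero_le_divide_iff)
    qed
    have cl: "closure {0..<z} = {0..z}" using z0 by simp
    have "0 \<le> f z"
      by (rule continuous_ge_on_closure[of "{0..<z}"]) (use before z0 cl fc in \<open>auto simp: less_imp_le\<close>)
    then have fz: "f z = 0" using zZ by (simp add: Z_def)
    have "0 \<le> u z"
      by (rule continuous_ge_on_closure[of "{0..<z}"]) (use u_before z0 cl uc in auto)
    moreover have "u z \<noteq> 0"
      using linear_system_nonvanishing[OF du df ca cb, of z] f0 z0 fz by auto
    ultimately have "0 < u z - f z" using fz by simp
    then obtain t where t: "0 \<le> t" "t \<le> z" "u t - f t = 0"
      using IVT'[of "\<lambda>t. u t - f t" 0 0 z] z0 u0 f0 by (auto intro!: continuous_intros uc fc)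
    then have "t < z" using \<open>0 < u z - f z\<close> by (cases "t = z") auto
    then show thesis using that[of t] t before by (force simp: S_def)
  qed
  have opn: "open {t. 0 < f t}"
    by (intro open_Collect_less continuous_intros fc)
  have nbhd: "\<exists>e>0. \<forall>t. \<bar>t - c\<bar> < e \<longrightarrow> 0 < f t" if "0 < f c" for c
    using opn that unfolding open_dist dist_real_def by blast
  obtain e0 where e0: "0 < e0" "\<And>t. \<bar>t\<bar> < e0 \<Longrightarrow> 0 < f t"
    using nbhd[OF f0] by auto
  obtain e1 where e1: "0 < e1" "\<And>t. \<bar>t - t1\<bar> < e1 \<Longrightarrow> 0 < f t"
    using nbhd[of t1] t1 by auto
  \<comment> \<open>The open interval extends beyond 0 and \<open>t1\<close>, so that
    \<open>\<tau>\<close> has a two-sided derivative even when the hitting time is 0 or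
    \<open>t1\<close>.\<close>
  define J where "J = {-e0<..<t1 + e1}"
  have Jpos: "0 < f t" if "t \<in> J" for t
    using that e0(2)[of t] t1(2)[of t] e1(2)[of t] t1(1) unfolding J_def by fastforce
  have mono: "S r < S t" if "r \<in> J" "t \<in> J" "r < t" for r t
  proof (rule DERIV_pos_imp_increasing[OF \<open>r < t\<close>], intro exI conjI)
    fix q assume "r \<le> q" "q \<le> t"
    then have "q \<in> J" using that by (auto simp: J_def)
    then show "(S has_real_derivative S' q) (at q)" using dS Jpos by force
    show "0 < S' q" using S'1[of q] by simp
  qed
  then have inj: "inj_on S J"
    by (intro inj_onI) (metis linorder_less_linear less_irrefl)
  define \<tau> where "\<tau> = the_inv_into J S"
  have \<tau>S: "\<tau> (S t) = t" if "t \<in> J" for t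
    unfolding \<tau>_def by (rule the_inv_into_f_f[OF inj that])
  have Sc: "continuous_on J S"
  proof (intro continuous_at_imp_continuous_on ballI)
    fix t assume "t \<in> J"
    then have "f t \<noteq> 0" using Jpos[of t] by simp
    then show "isCont S t" using DERIV_isCont[OF dS] by blast
  qed
  have sub: "{0..t1} \<subseteq> J" using e0 e1 by (auto simp: J_def)
  show ?thesis
  proof (intro exI[of _ \<tau>] ballI)
    fix s :: real assume s: "s \<in> {0..1}"
    have "S 0 \<le> s" "s \<le> S t1" using s t1(3) by (auto simp: S_def u0)
    then obtain t where t: "0 \<le> t" "t \<le> t1" "S t = s"
      using IVT'[of S 0 s t1] t1(1) continuous_on_subset[OF Sc sub] by blast
    have tJ: "t \<in> J" using t sub by auto
    have ts: "\<tau> s = t" using \<tau>S[OF tJ] t by simp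
    have ft: "f t \<noteq> 0" using Jpos[OF tJ] by simp
    have "(\<tau> has_derivative (*) (inverse (S' t))) (at (S t))"
    proof (rule has_derivative_inverse_strong[where S = J and f = S and f' = "(*) (S' t)"])
      show "(S has_derivative (*) (S' t)) (at t)"
        using dS[OF ft] by (simp add: has_field_derivative_def)
      show "(*) (S' t) \<circ> (*) (inverse (S' t)) = id"
        using S'1[of t] by (auto simp: fun_eq_iff)
    qed (use tJ Sc \<tau>S in \<open>auto simp: J_def\<close>)
    \<comment> \<open>Since \<open>S t = s\<close>, the slope \<open>S' t\<close> is expressed
      through \<open>s\<close> itself, which closes the equation in the new time variable.\<close>
    then have d: "(\<tau> has_real_derivative inverse (1 + (\<alpha> (\<tau> s) + s * \<beta> (\<tau> s))\<^sup>2)) (at s)"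
      using t ts by (simp add: has_field_derivative_def S'_def)
    \<comment> \<open>An earlier solution would lie in \<open>J\<close>, where \<open>S\<close> is
      strictly increasing and takes the value \<open>s\<close> only at \<open>t\<close>.\<close>
    have least: "t \<le> r" if "0 \<le> r" "u r = s * f r" for r
    proof (rule ccontr)
      assume "\<not> t \<le> r"
      then have r: "r \<in> J" "r < t" using that t sub by auto
      then have "S r < s" using mono[OF r(1) tJ] t by simp
      moreover have "S r = s" using that Jpos[OF r(1)] by (simp add: S_def)
      ultimately show False by simp
    qed
    show "0 \<le> \<tau> s \<and> f (\<tau> s) \<noteq> 0 \<and> u (\<tau> s) = s * f (\<tau> s)
            \<and> (\<forall>t. 0 \<le> t \<and> u t = s * f t \<longrightarrow> \<tau> s \<le> t)
            \<and> (\<tau> has_real_derivative inverse (1 + (\<alpha> (\<tau> s) + s * \<beta> (\<tau> s))\<^sup>2)) (at s)"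
      using d least t ft unfolding ts by (auto simp: S_def)
  qed
qed

text \<open>Replacing \<open>u\<close> and \<open>f\<close> by their negatives preserves both the
  linear system and the quotient, which reduces a negative \<open>f 0\<close> to the positive
  case.\<close>

lemma ratio_hits:
  fixes u f \<alpha> \<beta> :: "real \<Rightarrow> real"
  assumes du: "\<And>t. (u has_real_derivative (1 + (\<alpha> t)\<^sup>2) * f t + \<alpha> t * \<beta> t * u t) (at t)"
    and df: "\<And>t. (f has_real_derivative - \<alpha> t * \<beta> t * f t - (\<beta> t)\<^sup>2 * u t) (at t)"
    and ca: "continuous_on UNIV \<alpha>" and cb: "continuous_on UNIV \<beta>"
    and u0: "u 0 = 0" and f0: "f 0 \<noteq> 0"
  shows "\<exists>\<tau>. \<forall>s\<in>{0..1}. 0 \<le> \<tau> s \<and> f (\<tau> s) \<noteq> 0 \<and> u (\<tau> s) = s * f (\<tau> s)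
            \<and> (\<forall>t. 0 \<le> t \<and> u t = s * f t \<longrightarrow> \<tau> s \<le> t)
            \<and> (\<tau> has_real_derivative inverse (1 + (\<alpha> (\<tau> s) + s * \<beta> (\<tau> s))\<^sup>2)) (at s)"
proof (cases "f 0 > 0")
  case True
  then show ?thesis using ratio_hits_pos[OF du df ca cb u0] by blast
next
  case False
  have "((\<lambda>t. - u t) has_real_derivative (1 + (\<alpha> t)\<^sup>2) * (- f t) + \<alpha> t * \<beta> t * (- u t)) (at t)"
    "((\<lambda>t. - f t) has_real_derivative - \<alpha> t * \<beta> t * (- f t) - (\<beta> t)\<^sup>2 * (- u t)) (at t)" for t
    by (auto intro!: derivative_eq_intros du df simp: algebra_simps)
  from ratio_hits_pos[OF this ca cb] show ?thesis using u0 f0 False by simp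
qed

section \<open>Zero extensions of polynomials and the norm\<close>

text \<open>The clamp sends points outside \<open>{a..b}\<close> to an endpoint, where
  \<open>q\<close> vanishes; continuity of the extension is then that of a composition.\<close>

lemma zext_eq_clamp:
  assumes "a < b" "poly q a = 0" "poly q b = 0"
  shows "zext q a b x = poly q (max a (min b x))"
  using assms by (auto simp: zext_def max_def min_def)

lemma continuous_on_zext:
  assumes "a < b" "poly q a = 0" "poly q b = 0"
  shows "continuous_on S (zext q a b)"
proof -
  have "zext q a b = (\<lambda>x. poly q (max a (min b x)))"
    using zext_eq_clamp[OF assms] by auto
  then show ?thesis by (simp add: continuous_intros)
qed

text \<open>The delicate points are the endpoints: there \<open>q\<close> and its derivative vanish,
  so \<open>q\<close> is of smaller order than the distance, and cutting off only reduces its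
  absolute value.\<close>

lemma DERIV_zext:
  assumes ab: "a < b" and q: "poly q a = 0" "poly q b = 0"
    and q': "poly (pderiv q) a = 0" "poly (pderiv q) b = 0"
  shows "(zext q a b has_real_derivative zext (pderiv q) a b x) (at x)"
proof -
  consider "x < a \<or> b < x" | "a < x" "x < b" | "x = a \<or> x = b" by linarith
  then show ?thesis
  proof cases
    case 1
    have "((\<lambda>_. 0) has_real_derivative 0) (at x)" by simp
    then have "(zext q a b has_real_derivative 0) (at x)"
      by (rule has_field_derivative_transform_within_open[where S = "{..<a} \<union> {b<..}"])
        (use 1 in \<open>auto simp: zext_def\<close>)
    then show ?thesis using 1 by (auto simp: zext_def)
  next
    case 2
    have "(zext q a b has_real_derivative poly (pderiv q) x) (at x)"
      by (rule has_field_derivative_transform_within_open[OF poly_DERIV, where S = "{a<..<b}"])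
        (use 2 in \<open>auto simp: zext_def\<close>)
    then show ?thesis using 2 by (simp add: zext_def)
  next
    case 3
    have qx: "poly q x = 0" "poly (pderiv q) x = 0" using q q' 3 by auto
    have "(poly q has_real_derivative 0) (at x)"
      using poly_DERIV[of q x] qx by simp
    then have *: "\<And>e. e > 0 \<Longrightarrow> \<exists>d>0. \<forall>y. \<bar>y - x\<bar> < d \<longrightarrow> \<bar>poly q y\<bar> \<le> e * \<bar>y - x\<bar>"
      unfolding has_field_derivative_def has_derivative_at_alt by (simp add: qx)
    have "\<exists>d>0. \<forall>y. \<bar>y - x\<bar> < d \<longrightarrow> \<bar>zext q a b y\<bar> \<le> e * \<bar>y - x\<bar>" if e: "e > 0" for e
    proof -
      obtain d where d: "d > 0" "\<And>y. \<bar>y - x\<bar> < d \<Longrightarrow> \<bar>poly q y\<bar> \<le> e * \<bar>y - x\<bar>"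
        using *[OF e] by blast
      have "\<bar>zext q a b y\<bar> \<le> e * \<bar>y - x\<bar>" if "\<bar>y - x\<bar> < d" for y
        using d(2)[OF that] e by (auto simp: zext_def)
      then show ?thesis using d(1) by blast
    qed
    moreover have "zext q a b x = 0" "zext (pderiv q) a b x = 0"
      using qx by (auto simp: zext_def)
    ultimately show ?thesis
      unfolding has_field_derivative_def has_derivative_at_alt
      by (auto intro: bounded_linear_mult_right)
  qed
qed

text \<open>Continuity on a compact interval makes each supremum a true upper bound; each is at most
  the sum, since the others are nonnegative.\<close>

lemma nderiv_le_C2norm:
  assumes c: "\<And>k. k \<le> 2 \<Longrightarrow> continuous_on {a..b} (nderiv k f)"
    and "x \<in> {a..b}" "k \<le> 2"
  shows "\<bar>nderiv k f x\<bar> \<le> C2norm f a b"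
proof -
  have bdd: "bdd_above ((\<lambda>x. \<bar>nderiv i f x\<bar>) ` {a..b})" if "i \<le> 2" for i
    by (intro bounded_imp_bdd_above compact_imp_bounded compact_continuous_image
        continuous_intros c that compact_Icc)
  have up: "\<bar>nderiv i f x\<bar> \<le> (SUP x\<in>{a..b}. \<bar>nderiv i f x\<bar>)" if "i \<le> 2" for i
    by (rule cSUP_upper[OF assms(2) bdd[OF that]])
  have "\<bar>nderiv k f x\<bar> \<le> (SUP x\<in>{a..b}. \<bar>nderiv k f x\<bar>)" using up assms(3) .
  also have "\<dots> \<le> C2norm f a b" unfolding C2norm_def
    by (rule member_le_sum[of k "{..2}"]) (use assms(3) in \<open>auto intro: order_trans[OF abs_ge_zero up]\<close>)
  finally show ?thesis .
qed

section \<open>The hitting point as a flow in \<open>s\<close>\<close>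

text \<open>Where \<open>u = s * f\<close>, the velocity of \<open>\<xi>\<close> is
  \<open>- f * v\<close> with \<open>v = w1 + s * \<phi>1\<close>, and division by
  \<open>ds/dt = 1 + v^2\<close> gives the equation in the last claim. The third claim serves to
  confine the points that move to \<open>{a..b}\<close>.\<close>

lemma hit_time_reparametrisation:
  fixes \<xi> \<eta> :: "real \<Rightarrow> real \<Rightarrow> real" and w w1 \<phi> \<phi>1 :: "real \<Rightarrow> real"
  defines "g \<equiv> \<lambda>s x. \<xi> (hit_time \<xi> \<eta> w \<phi> s x) x"
  assumes dw: "\<And>x. (w has_real_derivative w1 x) (at x)"
    and d\<phi>: "\<And>x. (\<phi> has_real_derivative \<phi>1 x) (at x)"
    and cw1: "continuous_on UNIV w1" and c\<phi>1: "continuous_on UNIV \<phi>1"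
    and init: "\<xi> 0 x = x" "\<eta> 0 x = w x"
    and d\<xi>: "\<And>t. ((\<lambda>t. \<xi> t x) has_real_derivative
          - w1 (\<xi> t x) * \<phi> (\<xi> t x) - (\<eta> t x - w (\<xi> t x)) * \<phi>1 (\<xi> t x)) (at t)"
    and d\<eta>: "\<And>t. ((\<lambda>t. \<eta> t x) has_real_derivative \<phi> (\<xi> t x)) (at t)"
  shows "g 0 x = x"
    and "\<And>s. s \<in> {0..1} \<Longrightarrow> \<eta> (hit_time \<xi> \<eta> w \<phi> s x) x = w (g s x) + s * \<phi> (g s x)"
    and "\<And>s. s \<in> {0..1} \<Longrightarrow> g s x = x \<or> \<phi> x \<noteq> 0 \<and> \<phi> (g s x) \<noteq> 0"
    and "\<And>s. s \<in> {0..1} \<Longrightarrow> ((\<lambda>s. g s x) has_real_derivative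
          - \<phi> (g s x) * ((w1 (g s x) + s * \<phi>1 (g s x)) / (1 + (w1 (g s x) + s * \<phi>1 (g s x))\<^sup>2)))
          (at s within {0..1})"
proof -
  have "g 0 x = x \<and> (\<forall>s\<in>{0..1}. \<eta> (hit_time \<xi> \<eta> w \<phi> s x) x = w (g s x) + s * \<phi> (g s x) \<and>
      (g s x = x \<or> \<phi> x \<noteq> 0 \<and> \<phi> (g s x) \<noteq> 0) \<and> ((\<lambda>s. g s x) has_real_derivative
          - \<phi> (g s x) * ((w1 (g s x) + s * \<phi>1 (g s x)) / (1 + (w1 (g s x) + s * \<phi>1 (g s x))\<^sup>2)))
          (at s within {0..1}))"
  proof (cases "\<phi> x = 0")
    case True
    have "hit_time \<xi> \<eta> w \<phi> s x = 0" for s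
      unfolding hit_time_def by (rule cInf_eq_minimum) (use True init in auto)
    then show ?thesis by (simp add: g_def init True)
  next
    case False
    define u where "u t = \<eta> t x - w (\<xi> t x)" for t
    define f where "f t = \<phi> (\<xi> t x)" for t
    define \<alpha> where "\<alpha> t = w1 (\<xi> t x)" for t
    define \<beta> where "\<beta> t = \<phi>1 (\<xi> t x)" for t
    have c\<xi>: "continuous_on UNIV (\<lambda>t. \<xi> t x)"
      using d\<xi> DERIV_isCont continuous_at_imp_continuous_on by blast
    have ca: "continuous_on UNIV \<alpha>" and cb: "continuous_on UNIV \<beta>"
      unfolding \<alpha>_def \<beta>_def
      by (auto intro: continuous_on_compose2[OF cw1 c\<xi>] continuous_on_compose2[OF c\<phi>1 c\<xi>])
    have d\<xi>': "((\<lambda>t. \<xi> t x) has_real_derivative - \<alpha> t * f t - u t * \<beta> t) (at t)" for t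
      using d\<xi>[of t] by (simp add: \<alpha>_def \<beta>_def u_def f_def)
    have du: "(u has_real_derivative (1 + (\<alpha> t)\<^sup>2) * f t + \<alpha> t * \<beta> t * u t) (at t)" for t
    proof -
      have "(u has_real_derivative f t - \<alpha> t * (- \<alpha> t * f t - u t * \<beta> t)) (at t)"
        unfolding u_def[abs_def]
        using DERIV_diff[OF d\<eta>[of t] DERIV_chain2[OF dw d\<xi>'[of t]]]
        by (simp add: \<alpha>_def f_def u_def)
      then show ?thesis by (simp add: algebra_simps power2_eq_square)
    qed
    have df: "(f has_real_derivative - \<alpha> t * \<beta> t * f t - (\<beta> t)\<^sup>2 * u t) (at t)" for t
      using DERIV_chain2[OF d\<phi> d\<xi>'[of t]]
      by (simp add: \<beta>_def f_def[abs_def] algebra_simps power2_eq_square)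
    have "u 0 = 0" "f 0 \<noteq> 0" using False by (auto simp: u_def f_def init)
    from ratio_hits[OF du df ca cb this]
    obtain \<tau> where \<tau>: "\<And>s. s \<in> {0..1} \<Longrightarrow> 0 \<le> \<tau> s \<and> f (\<tau> s) \<noteq> 0 \<and> u (\<tau> s) = s * f (\<tau> s)
            \<and> (\<forall>t. 0 \<le> t \<and> u t = s * f t \<longrightarrow> \<tau> s \<le> t)
            \<and> (\<tau> has_real_derivative inverse (1 + (\<alpha> (\<tau> s) + s * \<beta> (\<tau> s))\<^sup>2)) (at s)"
      by blast
    have ht: "hit_time \<xi> \<eta> w \<phi> s x = \<tau> s" if "s \<in> {0..1}" for s
      unfolding hit_time_def
      by (rule cInf_eq_minimum) (use \<tau>[OF that] in \<open>auto simp: u_def f_def algebra_simps\<close>)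
    \<comment> \<open>Time 0 already solves the equation for \<open>s = 0\<close>, and
      \<open>\<tau>\<close> is the least solution.\<close>
    have "\<tau> 0 = 0" using \<tau>[of 0] \<open>u 0 = 0\<close> by force
    then have "g 0 x = x" using ht[of 0] by (simp add: g_def init)
    moreover have "\<eta> (hit_time \<xi> \<eta> w \<phi> s x) x = w (g s x) + s * \<phi> (g s x)"
      "\<phi> (g s x) \<noteq> 0" if "s \<in> {0..1}" for s
      using \<tau>[OF that] by (auto simp: g_def ht[OF that] u_def f_def)
    \<comment> \<open>The hitting time is identified with \<open>\<tau>\<close> on
      \<open>{0..1}\<close>, so the derivative is taken within that interval; the radius 1 in the
      transfer is arbitrary.\<close>
    moreover have "((\<lambda>s. g s x) has_real_derivative
          - \<phi> (g s x) * ((w1 (g s x) + s * \<phi>1 (g s x)) / (1 + (w1 (g s x) + s * \<phi>1 (g s x))\<^sup>2)))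
          (at s within {0..1})" if s: "s \<in> {0..1}" for s
    proof (rule has_field_derivative_transform_within[where f = "\<lambda>s. \<xi> (\<tau> s) x" and d = 1])
      let ?v = "\<alpha> (\<tau> s) + s * \<beta> (\<tau> s)"
      have "((\<lambda>s. \<xi> (\<tau> s) x) has_real_derivative
          (- \<alpha> (\<tau> s) * f (\<tau> s) - u (\<tau> s) * \<beta> (\<tau> s)) * inverse (1 + ?v\<^sup>2)) (at s within {0..1})"
        using DERIV_chain2[OF d\<xi>', of \<tau> "inverse (1 + ?v\<^sup>2)" s "{0..1}"]
          \<tau>[OF s] has_field_derivative_at_within by blast
      also have "(- \<alpha> (\<tau> s) * f (\<tau> s) - u (\<tau> s) * \<beta> (\<tau> s)) = - f (\<tau> s) * ?v"
        using \<tau>[OF s] by (simp add: algebra_simps)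
      finally show "((\<lambda>s. \<xi> (\<tau> s) x) has_real_derivative
          - \<phi> (g s x) * ((w1 (g s x) + s * \<phi>1 (g s x)) / (1 + (w1 (g s x) + s * \<phi>1 (g s x))\<^sup>2)))
          (at s within {0..1})"
        by (simp add: g_def ht[OF s] \<alpha>_def \<beta>_def f_def divide_inverse mult.assoc)
    qed (use s in \<open>auto simp: g_def ht\<close>)
    ultimately show ?thesis using False by blast
  qed
  then show "g 0 x = x"
    and "\<And>s. s \<in> {0..1} \<Longrightarrow> \<eta> (hit_time \<xi> \<eta> w \<phi> s x) x = w (g s x) + s * \<phi> (g s x)"
    and "\<And>s. s \<in> {0..1} \<Longrightarrow> g s x = x \<or> \<phi> x \<noteq> 0 \<and> \<phi> (g s x) \<noteq> 0"
    and "\<And>s. s \<in> {0..1} \<Longrightarrow> ((\<lambda>s. g s x) has_real_derivative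
          - \<phi> (g s x) * ((w1 (g s x) + s * \<phi>1 (g s x)) / (1 + (w1 (g s x) + s * \<phi>1 (g s x))\<^sup>2)))
          (at s within {0..1})"
    by blast+
qed

section \<open>Estimates for the derivatives of the hitting point\<close>

text \<open>Applied to the exponent \<open>I\<close> of the derivative of the flow, this turns
  smallness of \<open>I\<close> into closeness of that derivative to 1. Both signs follow from
  \<open>1 + y \<le> exp y\<close>, at \<open>y = - x\<close> or \<open>y = x\<close>.\<close>

lemma abs_exp_diff_one_le: "\<bar>exp x - 1\<bar> \<le> \<bar>x\<bar> * exp \<bar>x\<bar>" for x :: real
proof (cases "0 \<le> x")
  case True
  have "1 - x \<le> exp (- x)" using exp_ge_add_one_self[of "- x"] by simp
  then have "exp x * (1 - x) \<le> exp x * exp (- x)" by (intro mult_left_mono) auto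
  then show ?thesis using True by (simp add: exp_minus algebra_simps)
next
  case False
  have "\<bar>exp x - 1\<bar> \<le> \<bar>x\<bar> * 1" using exp_ge_add_one_self[of x] False by (simp del: exp_ge_add_one_self)
  also have "\<dots> \<le> \<bar>x\<bar> * exp \<bar>x\<bar>" by (intro mult_left_mono) auto
  finally show ?thesis .
qed

text \<open>This bound and the next, on the derivative of the same quotient, hold for all
  \<open>v\<close>; hence the size of \<open>w1 + s * \<phi>1\<close> does not enter the bounds on
  the velocity of the flow and its space derivative.\<close>

lemma abs_div_one_add_square_le: "\<bar>v / (1 + v\<^sup>2)\<bar> \<le> 1" for v :: real
proof -
  have "\<bar>v\<bar> \<le> 1 + v\<^sup>2" using sum_squares_bound[of "\<bar>v\<bar>" 1] by simp
  then show ?thesis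
    by (simp add: abs_divide divide_le_eq_1 add_pos_nonneg)
qed

lemma abs_deriv_div_one_add_square_le: "\<bar>(1 - v\<^sup>2) / (1 + v\<^sup>2)\<^sup>2\<bar> \<le> 1" for v :: real
proof -
  have "\<bar>1 - v\<^sup>2\<bar> \<le> 1 + v\<^sup>2" by (simp add: abs_le_iff)
  also have "\<dots> \<le> (1 + v\<^sup>2)\<^sup>2" by (rule self_le_power) auto
  finally show ?thesis
    by (simp add: abs_divide divide_le_eq_1 add_pos_nonneg)
qed

lemma DERIV_div_one_add_square:
  "((\<lambda>v. v / (1 + v\<^sup>2)) has_real_derivative (1 - v\<^sup>2) / (1 + v\<^sup>2)\<^sup>2) (at v)" for v :: real
proof -
  have "1 + v\<^sup>2 \<noteq> 0" using zero_le_power2[of v] by linarith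
  then show ?thesis
    by (auto intro!: derivative_eq_intros simp: power2_eq_square algebra_simps)
qed

text \<open>The bounds \<open>m\<close> on \<open>w1\<close> and \<open>w2\<close> are given on
  \<open>{a..b}\<close>. This suffices because a point starting outside does not move and a point
  starting inside ends inside. In the constant, \<open>c m * N\<close> bounds
  \<open>\<bar>exp I - 1\<bar>\<close>, where \<open>exp I\<close> is the derivative of the flow;
  the full factor \<open>(1 + m) * (1 + c m)\<close> comes from the estimate for
  \<open>\<eta>\<close>.\<close>

lemma hit_deriv_bounds:
  fixes \<xi> \<eta> :: "real \<Rightarrow> real \<Rightarrow> real" and w w1 w2 \<phi> \<phi>1 \<phi>2 :: "real \<Rightarrow> real"
  defines "c \<equiv> \<lambda>m. (2 + m) * exp (2 + m)"
  assumes dw: "\<And>x. (w has_real_derivative w1 x) (at x)"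
    and dw1: "\<And>x. (w1 has_real_derivative w2 x) (at x)"
    and d\<phi>: "\<And>x. (\<phi> has_real_derivative \<phi>1 x) (at x)"
    and d\<phi>1: "\<And>x. (\<phi>1 has_real_derivative \<phi>2 x) (at x)"
    and cw2: "continuous_on UNIV w2" and c\<phi>2: "continuous_on UNIV \<phi>2"
    and init: "\<And>x. \<xi> 0 x = x" "\<And>x. \<eta> 0 x = w x"
    and d\<xi>: "\<And>t x. ((\<lambda>t. \<xi> t x) has_real_derivative
          - w1 (\<xi> t x) * \<phi> (\<xi> t x) - (\<eta> t x - w (\<xi> t x)) * \<phi>1 (\<xi> t x)) (at t)"
    and d\<eta>: "\<And>t x. ((\<lambda>t. \<eta> t x) has_real_derivative \<phi> (\<xi> t x)) (at t)"
    and wb: "\<And>y. y \<in> {a..b} \<Longrightarrow> \<bar>w1 y\<bar> \<le> m" "\<And>y. y \<in> {a..b} \<Longrightarrow> \<bar>w2 y\<bar> \<le> m"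
    and \<phi>b: "\<And>y. \<bar>\<phi> y\<bar> \<le> N" "\<And>y. \<bar>\<phi>1 y\<bar> \<le> N" "\<And>y. \<bar>\<phi>2 y\<bar> \<le> N"
    and supp: "\<And>y. y \<notin> {a..b} \<Longrightarrow> \<phi> y = 0" "\<And>y. y \<notin> {a..b} \<Longrightarrow> \<phi>1 y = 0"
    and N1: "N \<le> 1" and m0: "0 \<le> m" and s: "s \<in> {0..1}"
  shows "(\<exists>D. ((\<lambda>y. \<xi> (hit_time \<xi> \<eta> w \<phi> s y) y) has_real_derivative D) (at x)
            \<and> \<bar>D - 1\<bar> \<le> (1 + m) * (1 + c m) * N)
       \<and> (\<exists>D. ((\<lambda>y. \<eta> (hit_time \<xi> \<eta> w \<phi> s y) y) has_real_derivative D) (at x)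
            \<and> \<bar>D - w1 x\<bar> \<le> (1 + m) * (1 + c m) * N)"
proof -
  define g where "g s x = \<xi> (hit_time \<xi> \<eta> w \<phi> s x) x" for s x
  define R where "R v = v / (1 + v\<^sup>2)" for v :: real
  define R' where "R' v = (1 - v\<^sup>2) / (1 + v\<^sup>2)\<^sup>2" for v :: real
  define G where "G s y = - \<phi> y * R (w1 y + s * \<phi>1 y)" for s y
  define G' where "G' s y = - \<phi>1 y * R (w1 y + s * \<phi>1 y)
      - \<phi> y * (R' (w1 y + s * \<phi>1 y) * (w2 y + s * \<phi>2 y))" for s y
  have cw1: "continuous_on X w1" and c\<phi>: "continuous_on X \<phi>" and c\<phi>1: "continuous_on X \<phi>1" for X
    by (intro continuous_at_imp_continuous_on ballI DERIV_isCont[OF dw1] DERIV_isCont[OF d\<phi>]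
        DERIV_isCont[OF d\<phi>1])+
  have N0: "0 \<le> N" using \<phi>b(1)[of 0] by linarith
  note reparam = hit_time_reparametrisation[where w = w and ?w1.0 = w1 and \<phi> = \<phi>
      and ?\<phi>1.0 = \<phi>1 and \<xi> = \<xi> and \<eta> = \<eta>,
      OF dw d\<phi> cw1 c\<phi>1 init d\<xi> d\<eta>, folded g_def]
  have g0: "g 0 y = y" for y by (rule reparam(1))
  have dg: "((\<lambda>s. g s y) has_real_derivative G r (g r y)) (at r within {0..1})" if "r \<in> {0..1}" for r y
    using reparam(4)[OF that] by (simp add: G_def R_def)
  have stay: "g r y = y \<or> y \<in> {a..b} \<and> g r y \<in> {a..b}" if "r \<in> {0..1}" for r y
    using reparam(3)[OF that, of y] supp(1) by blast
  have hg: "\<eta> (hit_time \<xi> \<eta> w \<phi> s y) y = w (g s y) + s * \<phi> (g s y)" for y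
    by (rule reparam(2)[OF s])
  have dG: "(G r has_real_derivative G' r y) (at y)" for r y
  proof -
    have dv: "((\<lambda>y. w1 y + r * \<phi>1 y) has_real_derivative w2 y + r * \<phi>2 y) (at y)"
      by (rule DERIV_add[OF dw1 DERIV_cmult[OF d\<phi>1]])
    have "((\<lambda>y. R (w1 y + r * \<phi>1 y)) has_real_derivative
        R' (w1 y + r * \<phi>1 y) * (w2 y + r * \<phi>2 y)) (at y)"
      unfolding R_def R'_def by (rule DERIV_chain2[OF DERIV_div_one_add_square dv])
    from DERIV_minus[OF DERIV_mult[OF d\<phi> this]] show ?thesis
      by (simp add: G_def[abs_def] G'_def algebra_simps)
  qed
  have cG': "continuous_on ({0..1} \<times> UNIV) (\<lambda>(s, y). G' s y)"
  proof -
    have pos: "1 + v\<^sup>2 \<noteq> 0" for v :: real using zero_le_power2[of v] by linarith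
    have snd: "continuous_on ({0..1::real} \<times> (UNIV::real set)) (\<lambda>p. q (snd p))"
      if "continuous_on UNIV q" for q :: "real \<Rightarrow> real"
      by (rule continuous_on_compose2[OF that]) (auto intro: continuous_intros)
    show ?thesis
      unfolding G'_def R_def R'_def case_prod_unfold
      by (intro continuous_intros snd cw1 c\<phi> c\<phi>1 cw2 c\<phi>2) (auto simp: pos)
  qed
  \<comment> \<open>On \<open>{a..b}\<close> the term of \<open>G'\<close> with the factor
    \<open>\<phi>1\<close> is at most \<open>N\<close> and the other at most
    \<open>N * (m + 1)\<close>, because \<open>\<bar>w2 y + r * \<phi>2 y\<bar> \<le> m + N\<close>
    and \<open>N \<le> 1\<close>.\<close>
  define L where "L = (2 + m) * N"
  have L0: "0 \<le> L" using N0 m0 by (simp add: L_def)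
  have G'0: "G' r y = 0" if "y \<notin> {a..b}" for r y
    using supp[OF that] by (simp add: G'_def)
  have G'L: "\<bar>G' r y\<bar> \<le> L" if r: "r \<in> {0..1}" for r y
  proof (cases "y \<in> {a..b}")
    case True
    let ?v = "w1 y + r * \<phi>1 y"
    have R: "\<bar>R v\<bar> \<le> 1" "\<bar>R' v\<bar> \<le> 1" for v
      unfolding R_def R'_def
      by (rule abs_div_one_add_square_le abs_deriv_div_one_add_square_le)+
    have "\<bar>\<phi>1 y * R ?v\<bar> \<le> N * 1"
      unfolding abs_mult by (intro mult_mono \<phi>b R) (use N0 in auto)
    moreover have "\<bar>\<phi> y * (R' ?v * (w2 y + r * \<phi>2 y))\<bar> \<le> N * (1 * (m + 1))"
    proof -
      have "\<bar>r * \<phi>2 y\<bar> \<le> 1 * N"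
        unfolding abs_mult by (intro mult_mono \<phi>b) (use r in auto)
      then have "\<bar>w2 y + r * \<phi>2 y\<bar> \<le> m + 1"
        using wb(2)[OF True] N1 by linarith
      then show ?thesis
        unfolding abs_mult by (intro mult_mono \<phi>b R) (use N0 m0 in auto)
    qed
    ultimately show ?thesis by (simp add: G'_def L_def algebra_simps)
  qed (use G'0 L0 in simp)
  \<comment> \<open>The velocity \<open>G\<close> is at most \<open>N\<close> in absolute value, and
    \<open>s\<close> is at most 1.\<close>
  have near: "\<bar>g s x - x\<bar> \<le> N"
  proof -
    have "\<bar>G r y\<bar> \<le> N * 1" for r y
      unfolding G_def abs_mult abs_minus_cancel
      by (intro mult_mono \<phi>b) (use N0 abs_div_one_add_square_le in \<open>auto simp: R_def\<close>)
    then have "norm (g s x - g 0 x) \<le> N * norm (s - 0)"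
      by (intro field_differentiable_bound[of "{0..1}" "\<lambda>s. g s x" "\<lambda>r. G r (g r x)"])
        (use s dg in auto)
    also have "\<dots> \<le> N" using s N0 by (auto intro: mult_left_le)
    finally show ?thesis by (simp add: g0)
  qed
  \<comment> \<open>For \<open>x\<close> outside \<open>{a..b}\<close> the value 0 forces
    \<open>exp I = 1\<close> exactly. There \<open>w1 x\<close> is not assumed to be bounded by
    \<open>m\<close>, so an approximate equality would not give the estimate for
    \<open>\<eta>\<close>.\<close>
  define B where "B = (if x \<in> {a..b} then L else 0)"
  have BL: "0 \<le> B" "B \<le> L" using L0 by (auto simp: B_def)
  have "\<bar>G' r (g r x)\<bar> \<le> B" if r: "r \<in> {0..1}" for r
    using stay[OF r, of x] G'L[OF r] G'0 by (auto simp: B_def)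
  from flow_deriv_initial[OF dG cG' G'L g0 dg this s]
  obtain I where I: "\<bar>I\<bar> \<le> B * s" and dgx: "(g s has_real_derivative exp I) (at x)" by blast
  have IB: "\<bar>I\<bar> \<le> B" using I s BL by (meson atLeastAtMost_iff mult_left_le order_trans)
  have c0: "0 \<le> c m" using m0 by (simp add: c_def)
  have "\<bar>exp I - 1\<bar> \<le> \<bar>I\<bar> * exp \<bar>I\<bar>" by (rule abs_exp_diff_one_le)
  also have "\<dots> \<le> B * exp (2 + m)"
  proof (intro mult_mono)
    \<comment> \<open>Origin of the exponent \<open>2 + m\<close> in \<open>c\<close>.\<close>
    have "L \<le> 2 + m" unfolding L_def using N1 m0 by (intro mult_left_le) auto
    then show "exp \<bar>I\<bar> \<le> exp (2 + m)" using IB BL by simp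
  qed (use IB BL in auto)
  finally have E: "\<bar>exp I - 1\<bar> \<le> B * exp (2 + m)" .
  also have "\<dots> \<le> L * exp (2 + m)" using BL by simp
  also have "\<dots> = c m * N" by (simp add: L_def c_def)
  finally have E': "\<bar>exp I - 1\<bar> \<le> c m * N" .
  have "\<bar>exp I - 1\<bar> \<le> (1 + m) * (1 + c m) * N"
  proof (rule order_trans[OF E' mult_right_mono[OF _ N0]])
    have "1 * c m \<le> (1 + m) * (1 + c m)" using m0 c0 by (intro mult_mono) auto
    then show "c m \<le> (1 + m) * (1 + c m)" by simp
  qed
  moreover have "((\<lambda>y. \<eta> (hit_time \<xi> \<eta> w \<phi> s y) y) has_real_derivative
      (w1 (g s x) + s * \<phi>1 (g s x)) * exp I) (at x)"
    unfolding hg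
    using DERIV_add[OF DERIV_chain2[OF dw dgx] DERIV_cmult[OF DERIV_chain2[OF d\<phi> dgx], of s]]
    by (simp add: algebra_simps)
  moreover have "\<bar>(w1 (g s x) + s * \<phi>1 (g s x)) * exp I - w1 x\<bar> \<le> (1 + m) * (1 + c m) * N"
  proof (cases "x \<in> {a..b}")
    case True
    then have gx: "g s x \<in> {a..b}" using stay[OF s, of x] by auto
    have "norm (w1 (g s x) - w1 x) \<le> m * norm (g s x - x)"
      by (rule field_differentiable_bound[of "{a..b}" w1 w2])
        (use True gx wb in \<open>auto intro: has_field_derivative_at_within dw1\<close>)
    also have "\<dots> \<le> m * N" using near m0 by (intro mult_left_mono) auto
    finally have 1: "\<bar>w1 (g s x) - w1 x\<bar> \<le> m * N" by simp
    have 2: "\<bar>w1 (g s x) * (exp I - 1)\<bar> \<le> m * (c m * N)"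
      unfolding abs_mult by (intro mult_mono wb gx E') (use m0 in auto)
    have "c m * N \<le> c m" using c0 N1 by (intro mult_left_le) auto
    then have e: "\<bar>exp I\<bar> \<le> 1 + c m" using E' by linarith
    have "\<bar>s * \<phi>1 (g s x) * exp I\<bar> \<le> 1 * N * (1 + c m)"
      unfolding abs_mult[of "s * \<phi>1 (g s x)"]
      by (intro mult_mono e) (use \<phi>b s N0 in \<open>auto simp: abs_mult intro: mult_mono[of _ 1 _ N, simplified]\<close>)
    \<comment> \<open>The three terms are bounded by \<open>m * N\<close>,
      \<open>m * (c m * N)\<close> and \<open>N * (1 + c m)\<close>, whose sum is exactly
      \<open>(1 + m) * (1 + c m) * N\<close>.\<close>
    moreover have "(w1 (g s x) + s * \<phi>1 (g s x)) * exp I - w1 x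
        = (w1 (g s x) - w1 x) + w1 (g s x) * (exp I - 1) + s * \<phi>1 (g s x) * exp I"
      by (simp add: algebra_simps)
    ultimately have "\<bar>(w1 (g s x) + s * \<phi>1 (g s x)) * exp I - w1 x\<bar>
        \<le> m * N + m * (c m * N) + 1 * N * (1 + c m)"
      using 1 2 by linarith
    also have "\<dots> = (1 + m) * (1 + c m) * N" by (simp add: algebra_simps)
    finally show ?thesis .
  next
    case False
    then have "g s x = x" "exp I = 1" using stay[OF s, of x] E by (auto simp: B_def)
    then show ?thesis using supp(2)[OF False] N0 m0 c0 by simp
  qed
  ultimately show ?thesis using dgx unfolding g_def by blast
qed

section \<open>Application to the zero-extended polynomial\<close>

theorem theorem3p8:
  fixes M :: real
  shows "\<exists>C0>0. \<forall>(w::real\<Rightarrow>real) (a::real) (b::real) (p::real poly)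
           (\<xi>::real\<Rightarrow>real\<Rightarrow>real) (\<eta>::real\<Rightarrow>real\<Rightarrow>real).
     Ck 3 w \<and> periodic w \<and> (\<forall>x\<in>{-1..1}. w x > 0) \<and>
     -1 < a \<and> a < b \<and> b < 1 \<and>
     (\<forall>k\<le>3. poly ((pderiv ^^ k) p) a = 0 \<and> poly ((pderiv ^^ k) p) b = 0) \<and>
     (\<forall>x. \<xi> 0 x = x \<and> \<eta> 0 x = w x) \<and>
     (\<forall>x t. ((\<lambda>t. \<xi> t x) has_real_derivative
               (- deriv w (\<xi> t x) * zext p a b (\<xi> t x)
                - (\<eta> t x - w (\<xi> t x)) * zext (pderiv p) a b (\<xi> t x))) (at t)) \<and>
     (\<forall>x t. ((\<lambda>t. \<eta> t x) has_real_derivative zext p a b (\<xi> t x)) (at t)) \<and>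
     C2norm w a b \<le> M \<and> C2norm (zext p a b) a b < 1
     \<longrightarrow> (\<forall>s\<in>{0..1}. \<forall>x.
           (\<exists>D. ((\<lambda>y. \<xi> (hit_time \<xi> \<eta> w (zext p a b) s y) y) has_real_derivative D) (at x)
                \<and> \<bar>D - 1\<bar> \<le> C0 * C2norm (zext p a b) a b) \<and>
           (\<exists>D. ((\<lambda>y. \<eta> (hit_time \<xi> \<eta> w (zext p a b) s y) y) has_real_derivative D) (at x)
                \<and> \<bar>D - deriv w x\<bar> \<le> C0 * C2norm (zext p a b) a b))"
proof (rule exI[of _ "(1 + \<bar>M\<bar>) * (1 + (2 + \<bar>M\<bar>) * exp (2 + \<bar>M\<bar>))"], intro conjI allI impI, goal_cases)
  case 1
  \<comment> \<open>The witness is the constant of \<open>hit_deriv_bounds\<close> at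
    \<open>m = \<bar>M\<bar>\<close>; the absolute value makes it positive for every real
    \<open>M\<close>.\<close>
  show ?case by (intro mult_pos_pos add_pos_nonneg mult_nonneg_nonneg) auto
next
  case (2 w a b p \<xi> \<eta>)
  then have C3: "Ck 3 w" and ab: "a < b"
    and bd: "\<And>k. k \<le> 3 \<Longrightarrow> poly ((pderiv ^^ k) p) a = 0 \<and> poly ((pderiv ^^ k) p) b = 0"
    and init: "\<And>x. \<xi> 0 x = x" "\<And>x. \<eta> 0 x = w x"
    and d\<xi>: "\<And>t x. ((\<lambda>t. \<xi> t x) has_real_derivative
               (- deriv w (\<xi> t x) * zext p a b (\<xi> t x)
                - (\<eta> t x - w (\<xi> t x)) * zext (pderiv p) a b (\<xi> t x))) (at t)"
    and d\<eta>: "\<And>t x. ((\<lambda>t. \<eta> t x) has_real_derivative zext p a b (\<xi> t x)) (at t)"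
    and M: "C2norm w a b \<le> M" and N1: "C2norm (zext p a b) a b < 1"
    by blast+
  let ?N = "C2norm (zext p a b) a b"
  define w2 where "w2 = nderiv 2 w"
  have nw: "nderiv 0 w = w" "nderiv (Suc 0) w = deriv w" "nderiv (Suc (Suc 0)) w = w2"
    by (simp_all add: nderiv_def w2_def numeral_2_eq_2)
  have dw': "(nderiv k w has_real_derivative nderiv (Suc k) w x) (at x)" if "k < 3" for k x
    using C3 that by (simp add: Ck_def)
  have dw: "(w has_real_derivative deriv w x) (at x)" for x
    using dw'[of 0 x] by (simp add: nw)
  have dw1: "(deriv w has_real_derivative w2 x) (at x)" for x
    using dw'[of "Suc 0" x] by (simp add: nw)
  have cw: "continuous_on S (nderiv k w)" if "k \<le> 2" for k S
    using that by (intro continuous_at_imp_continuous_on ballI DERIV_isCont[OF dw']) simp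
  have cw2: "continuous_on UNIV w2" using cw[of 2] by (simp add: w2_def)
  define \<phi>2 where "\<phi>2 = zext (pderiv (pderiv p)) a b"
  have bd': "poly p c = 0" "poly (pderiv p) c = 0" "poly (pderiv (pderiv p)) c = 0"
    if "c = a \<or> c = b" for c
    using bd[of 0] bd[of 1] bd[of 2] that by (auto simp: numeral_2_eq_2)
  have d\<phi>: "(zext p a b has_real_derivative zext (pderiv p) a b x) (at x)" for x
    by (rule DERIV_zext[OF ab]) (simp_all add: bd')
  have d\<phi>1: "(zext (pderiv p) a b has_real_derivative \<phi>2 x) (at x)" for x
    unfolding \<phi>2_def by (rule DERIV_zext[OF ab]) (simp_all add: bd')
  have c\<phi>2: "continuous_on S \<phi>2" for S
    unfolding \<phi>2_def by (rule continuous_on_zext[OF ab]) (simp_all add: bd')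
  \<comment> \<open>The norm is defined by iterating \<open>deriv\<close> on the extension. As the
    extension is differentiable on the whole line, these derivatives are the extensions of the
    polynomial derivatives, also at \<open>a\<close> and \<open>b\<close>.\<close>
  have "deriv (zext p a b) = zext (pderiv p) a b" "deriv (zext (pderiv p) a b) = \<phi>2"
    using DERIV_imp_deriv[OF d\<phi>] DERIV_imp_deriv[OF d\<phi>1] by auto
  then have n\<phi>: "nderiv 0 (zext p a b) = zext p a b"
    "nderiv (Suc 0) (zext p a b) = zext (pderiv p) a b" "nderiv (Suc (Suc 0)) (zext p a b) = \<phi>2"
    by (simp_all add: nderiv_def)
  have "continuous_on S (zext p a b)" "continuous_on S (zext (pderiv p) a b)" for S
    by (intro continuous_at_imp_continuous_on ballI DERIV_isCont[OF d\<phi>] DERIV_isCont[OF d\<phi>1])+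
  note c = this c\<phi>2
  have c\<phi>: "continuous_on S (nderiv k (zext p a b))" if "k \<le> 2" for k S
  proof -
    have "k = 0 \<or> k = Suc 0 \<or> k = Suc (Suc 0)" using that by auto
    then show ?thesis
      using c by (auto simp: n\<phi>)
  qed
  have wb: "\<bar>nderiv k w y\<bar> \<le> \<bar>M\<bar>" if "y \<in> {a..b}" "k \<le> 2" for k y
    using nderiv_le_C2norm[OF cw that] M by linarith
  have \<phi>b: "\<bar>nderiv k (zext p a b) y\<bar> \<le> ?N" if "y \<in> {a..b}" "k \<le> 2" for k y
    using nderiv_le_C2norm[OF c\<phi> that] .
  have N0: "0 \<le> ?N" using \<phi>b[of a 0] ab by (simp add: order_trans[OF abs_ge_zero])
  have supp: "zext q a b y = 0" if "y \<notin> {a..b}" for q y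
    using that by (auto simp: zext_def)
  \<comment> \<open>The norm controls these functions on \<open>{a..b}\<close>; outside they vanish,
    and the bound becomes the nonnegativity of the norm.\<close>
  have \<phi>b': "\<bar>zext p a b y\<bar> \<le> ?N" "\<bar>zext (pderiv p) a b y\<bar> \<le> ?N" "\<bar>\<phi>2 y\<bar> \<le> ?N" for y
    using \<phi>b[of y 0] \<phi>b[of y "Suc 0"] \<phi>b[of y "Suc (Suc 0)"] supp[of y] N0
    by (cases "y \<in> {a..b}"; simp add: n\<phi> \<phi>2_def)+
  show ?case
  proof (intro ballI allI)
    fix s x :: real assume s: "s \<in> {0..1}"
    show "(\<exists>D. ((\<lambda>y. \<xi> (hit_time \<xi> \<eta> w (zext p a b) s y) y) has_real_derivative D) (at x)
                \<and> \<bar>D - 1\<bar> \<le> (1 + \<bar>M\<bar>) * (1 + (2 + \<bar>M\<bar>) * exp (2 + \<bar>M\<bar>)) * ?N) \<and>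
           (\<exists>D. ((\<lambda>y. \<eta> (hit_time \<xi> \<eta> w (zext p a b) s y) y) has_real_derivative D) (at x)
                \<and> \<bar>D - deriv w x\<bar> \<le> (1 + \<bar>M\<bar>) * (1 + (2 + \<bar>M\<bar>) * exp (2 + \<bar>M\<bar>)) * ?N)"
    proof (rule hit_deriv_bounds[OF dw dw1 d\<phi> d\<phi>1 cw2 c\<phi>2 init d\<xi> d\<eta> _ _ \<phi>b' _ _ _ _ s])
      show "\<bar>deriv w y\<bar> \<le> \<bar>M\<bar>" "\<bar>w2 y\<bar> \<le> \<bar>M\<bar>" if "y \<in> {a..b}" for y
        using wb[OF that, of "Suc 0"] wb[OF that, of "Suc (Suc 0)"] by (simp_all add: nw)
    qed (use supp N1 in auto)
  qed
qed

end
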